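(* Let $A\in\mathbb{C}^{n\times n}$, $D\in\mathbb{C}^{m\times m}$, $B\in\mathbb{C}^{m\times n}$, $C\in\mathbb{C}^{n\times m}$, and put $S=A-CD^{d}B$, $Z=D-BA^{d}C$, $H=BA^{d}$, $K=A^{d}C$, $k=\operatorname{ind}(A)$. If $A^{\pi}CD^{d}B=0$ and $KD^{\pi}Z^{d}H=KD^{d}Z^{\pi}H$, then $$S^{d}=A^{d}+KZ^{d}H+\sum_{i=0}^{k-1}(A^{d}+KZ^{d}H)^{i+2}SA^{i}A^{\pi},$$ or alternatively (the following formula also holds) $$S^{d}=A^{d}+A^{d}CZ^{d}BA^{d}-\sum_{i=0}^{k-1}(A^{d}+A^{d}CZ^{d}BA^{d})^{i+1}A^{d}CZ^{d}BA^{i}A^{\pi}+\sum_{i=0}^{k-1}(A^{d}+A^{d}CZ^{d}BA^{d})^{i+1}A^{d}C(Z^{d}D^{\pi}-Z^{\pi}D^{d})BA^{i}.$$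
   Context: For a square complex matrix $X$, $\operatorname{ind}(X)$ is the smallest non-negative integer $k$ with $\operatorname{rank}(X^{k})=\operatorname{rank}(X^{k+1})$, and the Drazin inverse $X^{d}$ is the unique matrix with $XX^{d}=X^{d}X$, $X^{d}XX^{d}=X^{d}$, $X^{k}=X^{k+1}X^{d}$ for $k=\operatorname{ind}(X)$. Write $X^{\pi}=I-XX^{d}$. Conventions: $X^{0}=I$ for every square matrix $X$, and $\sum_{i=0}^{k}\ast=0$ if $k<0$. *)

theory Defs
  imports "HOL-Analysis.Analysis"
begin

(* The library's power operation on type vec is componentwise, hence not the matrix power. *)
primrec matpow :: "complex^'n^'n \<Rightarrow> nat \<Rightarrow> complex^'n^'n" where
  "matpow X 0 = mat 1"
| "matpow X (Suc j) = X ** matpow X j"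

definition mat_ind :: "complex^'n^'n \<Rightarrow> nat" where
  "mat_ind X = (LEAST j. rank (matpow X j) = rank (matpow X (j + 1)))"

definition is_drazin_inverse :: "complex^'n^'n \<Rightarrow> complex^'n^'n \<Rightarrow> bool" where
  "is_drazin_inverse X Y \<longleftrightarrow>
     X ** Y = Y ** X \<and> Y ** X ** Y = Y \<and>
     matpow X (mat_ind X) = matpow X (mat_ind X + 1) ** Y"

(* See drazin_inverse_ex1 below for existence and uniqueness. *)
definition drazin_inverse :: "complex^'n^'n \<Rightarrow> complex^'n^'n"  (\<open>_\<^sup>d\<close> [1000] 1000) where
  "X\<^sup>d = (THE Y. is_drazin_inverse X Y)"

definition spectral_idem :: "complex^'n^'n \<Rightarrow> complex^'n^'n"  (\<open>_\<^sup>\<pi>\<close> [1000] 1000) where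
  "X\<^sup>\<pi> = mat 1 - X ** X\<^sup>d"

lemma matpow_add: "matpow X (i + j) = matpow X i ** matpow X j"
  by (induction i) (simp_all add: matrix_mul_assoc)

lemma matpow_Suc2: "matpow X (Suc j) = matpow X j ** X"
  using matpow_add[of X j 1] by simp

lemma row_eq_nth: "row i M = M $ i"
  by (simp add: row_def vec_eq_iff)

lemma row_matrix_mult: "row i (V ** M) = row i V v* M"
  by (simp add: row_def matrix_matrix_mult_def vector_matrix_mult_def vec_eq_iff mult.commute)

lemma span_rows: "vec.span (rows (M::complex^'n^'n)) = range (\<lambda>x. x v* M)"
proof
  have "vec.subspace (range (\<lambda>x. x v* M))"
  proof (rule vec.subspaceI)
    have "0 v* M = 0"
      by (simp add: vector_matrix_mult_def vec_eq_iff)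
    then show "0 \<in> range (\<lambda>x. x v* M)"
      by (metis rangeI)
  next
    fix x y assume "x \<in> range (\<lambda>x. x v* M)" "y \<in> range (\<lambda>x. x v* M)"
    then obtain a b where "x = a v* M" "y = b v* M" by blast
    then have "x + y = (a + b) v* M"
      by (simp add: vector_matrix_mult_def vec_eq_iff algebra_simps sum.distrib)
    then show "x + y \<in> range (\<lambda>x. x v* M)" by simp
  next
    fix c x assume "x \<in> range (\<lambda>x. x v* M)"
    then obtain a where "x = a v* M" by blast
    then have "c *s x = (c *s a) v* M"
      by (simp add: vector_matrix_mult_def vec_eq_iff sum_distrib_left mult.assoc mult.left_commute)
    then show "c *s x \<in> range (\<lambda>x. x v* M)" by simp
  qed
  moreover have "rows M \<subseteq> range (\<lambda>x. x v* M)"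
  proof
    fix x assume "x \<in> rows M"
    then obtain i where "x = row i M" by (auto simp: rows_def)
    then have "x = row i (mat 1) v* M"
      using row_matrix_mult[of i "mat 1" M] by simp
    then show "x \<in> range (\<lambda>x. x v* M)" by simp
  qed
  ultimately show "vec.span (rows M) \<subseteq> range (\<lambda>x. x v* M)"
    by (intro vec.span_minimal)
  show "range (\<lambda>x. x v* M) \<subseteq> vec.span (rows M)"
  proof (rule image_subsetI)
    fix x :: "complex^'n"
    have "x v* M = (\<Sum>i\<in>UNIV. x $ i *s row i M)"
      by (simp add: vector_matrix_mult_def row_def vec_eq_iff mult.commute)
    moreover have "(\<Sum>i\<in>UNIV. x $ i *s row i M) \<in> vec.span (rows M)"
      by (intro vec.span_sum vec.span_scale vec.span_base) (auto simp: rows_def)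
    ultimately show "x v* M \<in> vec.span (rows M)" by simp
  qed
qed

lemma rows_mult_subset: "rows (V ** M) \<subseteq> vec.span (rows (M::complex^'n^'n))"
  unfolding span_rows by (auto simp: rows_def row_matrix_mult)

lemma rank_mult_le: "rank (V ** M) \<le> rank (M::complex^'n^'n)"
  unfolding row_rank_def_gen by (rule vec.dim_mono) (rule rows_mult_subset)

lemma rank_eq_imp_factor:
  fixes M V :: "complex^'n^'n"
  assumes "rank (V ** M) = rank M"
  obtains W where "M = W ** (V ** M)"
proof -
  have "vec.span (rows (V ** M)) = vec.span (rows M)"
    using vec.dim_eq_span[of "rows (V ** M)" "vec.span (rows M)"] rows_mult_subset[of V M] assms
    by (simp add: row_rank_def_gen)
  then have "\<forall>i. \<exists>w. row i M = w v* (V ** M)"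
    unfolding span_rows[of "V ** M"]
    by (metis (mono_tags, lifting) imageE mem_Collect_eq rows_def vec.span_base UNIV_I)
  then obtain w where w: "\<And>i. row i M = w i v* (V ** M)"
    by metis
  have "M = (\<chi> i. w i) ** (V ** M)"
  proof (subst vec_eq_iff, rule allI)
    fix i
    show "M $ i = ((\<chi> i. w i) ** (V ** M)) $ i"
      using w[of i] row_matrix_mult[of i "\<chi> i. w i" "V ** M"] by (simp add: row_eq_nth)
  qed
  then show thesis by (rule that)
qed

lemma mat_ind_rank: "rank (matpow X (mat_ind X)) = rank (matpow X (mat_ind X + 1))"
proof -
  have "\<exists>j. rank (matpow X j) = rank (matpow X (j + 1))"
  proof (rule ccontr)
    assume "\<not> ?thesis"
    then have less: "rank (matpow X (Suc j)) < rank (matpow X j)" for j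
      using rank_mult_le[of X "matpow X j"] by (metis Suc_eq_plus1 le_neq_implies_less matpow.simps(2))
    have "rank (matpow X j) + j \<le> rank (matpow X 0)" for j
    proof (induction j)
      case (Suc j)
      then show ?case using less[of j] by linarith
    qed simp
    from this[of "Suc (rank (matpow X 0))"] show False by simp
  qed
  then show ?thesis unfolding mat_ind_def by (rule LeastI_ex)
qed

lemma matpow_factors:
  obtains V W where
    "matpow X (mat_ind X) = V ** matpow X (Suc (mat_ind X))"
    "matpow X (mat_ind X) = matpow X (Suc (mat_ind X)) ** W"
proof -
  define P where "P = matpow X (mat_ind X)"
  obtain V where V: "P = V ** (X ** P)"
    using rank_eq_imp_factor[of X P] mat_ind_rank[of X] by (auto simp: P_def)
  define R where "R = range ((*v) P)"
  have R: "vec.subspace R"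
    unfolding R_def
    by (rule vec.linear_subspace_image) (auto simp: vec.subspace_UNIV)
  have XR: "(*v) X ` R = range ((*v) (X ** P))"
    by (auto simp: R_def matrix_vector_mul_assoc image_image)
  have "inj_on ((*v) X) R"
  proof (rule inj_onI)
    fix x y assume "x \<in> R" "y \<in> R" and eq: "X *v x = X *v y"
    then obtain a b where "x = P *v a" "y = P *v b" by (auto simp: R_def)
    then show "x = y"
      by (metis V eq matrix_vector_mul_assoc)
  qed
  then have "vec.dim ((*v) X ` R) = vec.dim R"
    by (intro vec.dim_image_eq) (simp_all add: vec.span_eq_iff[THEN iffD2, OF R])
  moreover have "(*v) X ` R \<subseteq> R"
    by (auto simp: R_def P_def matrix_vector_mul_assoc simp flip: matpow.simps)
       (auto simp: matpow_Suc2 simp flip: matrix_vector_mul_assoc simp del: matpow.simps)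
  moreover have "vec.subspace ((*v) X ` R)"
    using R by (intro vec.linear_subspace_image) auto
  ultimately have "R = range ((*v) (X ** P))"
    using vec.subspace_dim_equal[of "(*v) X ` R" R] R XR by simp
  then have "\<exists>w. P *v axis j 1 = (X ** P) *v w" for j
    unfolding R_def by blast
  then have "\<exists>w. \<forall>j. P *v axis j 1 = (X ** P) *v w j"
    by (intro choice allI)
  then obtain w where w: "P *v axis j 1 = (X ** P) *v w j" for j
    by blast
  have "P = (X ** P) ** (\<chi> i j. w j $ i)"
  proof -
    have "P $ i $ j = ((X ** P) ** (\<chi> i j. w j $ i)) $ i $ j" for i j
    proof -
      have "P $ i $ j = (P *v axis j 1) $ i"
        by (simp add: matrix_vector_mult_def axis_def mult_delta_right)
      also have "\<dots> = ((X ** P) ** (\<chi> i j. w j $ i)) $ i $ j"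
        unfolding w by (simp add: matrix_vector_mult_def matrix_matrix_mult_def)
      finally show ?thesis .
    qed
    then show ?thesis by (simp add: vec_eq_iff)
  qed
  from V this show thesis
    unfolding P_def matpow.simps(2)[symmetric] by (rule that)
qed

lemma matpow_mult_drazin:
  assumes "X ** Y = Y ** X"
  shows "Y ** matpow X j = matpow X j ** Y"
  by (induction j) (simp_all add: matrix_mul_assoc flip: assms, metis matrix_mul_assoc)

lemma drazin_inverse_aux:
  assumes "X ** Y = Y ** X" "Y ** X ** Y = Y"
  shows "matpow X (Suc j) ** matpow Y (Suc j) = X ** Y"
proof (induction j)
  case (Suc j)
  have "matpow X (Suc (Suc j)) ** matpow Y (Suc (Suc j))
      = X ** (matpow X (Suc j) ** matpow Y (Suc j)) ** Y"
    by (simp only: matpow_Suc2[of Y "Suc j"] matpow.simps(2)[of X "Suc j"] matrix_mul_assoc)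
  also have "\<dots> = X ** Y"
    by (metis Suc assms matrix_mul_assoc)
  finally show ?case .
qed simp

lemma is_drazin_inverse_unique:
  assumes "is_drazin_inverse X Y" "is_drazin_inverse X Y'"
  shows "Y = Y'"
proof -
  define k where "k = mat_ind X"
  have Y: "X ** Y = Y ** X" "Y ** X ** Y = Y" "matpow X k = matpow X (Suc k) ** Y"
   and Y': "X ** Y' = Y' ** X" "Y' ** X ** Y' = Y'" "matpow X k = matpow X (Suc k) ** Y'"
    using assms by (simp_all add: is_drazin_inverse_def k_def)
  note YX = drazin_inverse_aux[OF Y(1,2), of k] and YX' = drazin_inverse_aux[OF Y'(1,2), of k]
  have swap: "matpow Y j ** matpow X j = matpow X j ** matpow Y j" for j
  proof -
    have "X ** matpow Y j = matpow Y j ** X" for j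
      by (rule matpow_mult_drazin) (simp add: Y(1))
    then show ?thesis
      by (metis matpow_mult_drazin)
  qed
  have "X ** Y = matpow Y (Suc k) ** matpow X (Suc k)"
    using YX swap by metis
  also have "\<dots> = matpow Y (Suc k) ** (matpow X (Suc k) ** X ** Y')"
    using Y'(3) by (metis Y'(1) matpow.simps(2) matpow_Suc2 matrix_mul_assoc)
  also have "\<dots> = X ** Y ** X ** Y'"
    using YX swap by (metis matrix_mul_assoc)
  finally have 1: "X ** Y = X ** Y ** X ** Y'" .
  have "X ** Y' = matpow X (Suc k) ** matpow Y' (Suc k)"
    using YX' by simp
  also have "\<dots> = (Y ** X ** matpow X (Suc k)) ** matpow Y' (Suc k)"
    using Y(3) by (metis Y(1) matpow.simps(2) matpow_Suc2 matpow_mult_drazin matrix_mul_assoc)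
  also have "\<dots> = Y ** X ** X ** Y'"
    using YX' by (metis matrix_mul_assoc)
  finally have 2: "X ** Y' = Y ** X ** X ** Y'" .
  have 3: "X ** Y = X ** Y'"
    using 1 2 Y(1) by (metis matrix_mul_assoc)
  have "Y = Y ** (X ** Y')"
    using 3 Y(2) by (metis matrix_mul_assoc)
  also have "\<dots> = Y'"
    using 3 Y(1) Y'(1,2) by (metis matrix_mul_assoc)
  finally show ?thesis .
qed

lemma drazin_inverse_ex1: "\<exists>!Y. is_drazin_inverse X Y"
proof (rule ex_ex1I)
  define k where "k = mat_ind X"
  obtain V W where V: "matpow X k = V ** matpow X (Suc k)"
    and W: "matpow X k = matpow X (Suc k) ** W"
    unfolding k_def by (rule matpow_factors)
  have VW: "V ** matpow X k = matpow X k ** W"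
    using V W by (metis matpow_Suc2 matpow.simps(2) matrix_mul_assoc)
  have powV: "matpow V j ** matpow X k = matpow X k ** matpow W j" for j
    by (induction j) (simp_all add: VW flip: matrix_mul_assoc,
        metis VW matrix_mul_assoc)
  have powW: "matpow X (j + k) ** matpow W j = matpow X k" for j
  proof (induction j)
    case (Suc j)
    have "matpow X (Suc j + k) ** matpow W (Suc j) = matpow X j ** (matpow X (Suc k) ** W) ** matpow W j"
      by (simp add: matrix_mul_assoc flip: matpow_add) (metis add_Suc_right matpow.simps(2) matpow_add matrix_mul_assoc)
    also have "\<dots> = matpow X k"
      using Suc by (simp only: W[symmetric] matpow_add)
    finally show ?case .
  qed simp
  define Y where "Y = matpow X k ** matpow W (Suc k)"
  have Y': "Y = matpow V (Suc k) ** matpow X k"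
    by (simp only: Y_def powV)
  have XY: "X ** Y = matpow X k ** matpow W k"
  proof -
    have "X ** Y = (matpow X (Suc k) ** W) ** matpow W k"
      by (simp add: Y_def matrix_mul_assoc)
    then show ?thesis by (simp only: W[symmetric])
  qed
  have YX: "Y ** X = matpow V k ** matpow X k"
  proof -
    have "Y ** X = matpow V k ** (V ** matpow X (Suc k))"
      by (simp only: Y' matpow_Suc2 matrix_mul_assoc)
    then show ?thesis by (simp only: V[symmetric])
  qed
  have YXY: "Y ** X ** Y = Y"
  proof -
    have "Y ** X ** Y = matpow V (Suc k) ** (matpow X (k + k) ** matpow W k)"
      by (simp only: Y' XY matpow_add flip: matrix_mul_assoc) (simp only: XY flip: Y')
    then show ?thesis by (simp only: powW Y')
  qed
  have "matpow X (k + 1) ** Y = matpow X (Suc k + k) ** matpow W (Suc k)"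
    using matpow_add[of X "Suc k" k] by (simp only: Y_def Suc_eq_plus1 matrix_mul_assoc)
  then have "matpow X k = matpow X (k + 1) ** Y"
    by (simp only: powW)
  then have "is_drazin_inverse X Y"
    unfolding is_drazin_inverse_def using XY YX YXY powV by (simp add: k_def)
  then show "\<exists>Y. is_drazin_inverse X Y" ..
qed (rule is_drazin_inverse_unique)

end

theory Submission
  imports Defs
begin

text \<open>
  Put e = A A^d, p = 1 - e and M = A^d + K Z^d H. The condition A^\<pi> C D^d B = 0 makes S block upper
  triangular for the decomposition 1 = e + p, with nilpotent lower block p A. The second condition
  says exactly that S M = e, so M is a one-sided, hence (the corner ring of e being
  finite-dimensional) two-sided inverse of the upper block S e. The Drazin inverse of a block
  triangular matrix with invertible upper and nilpotent lower block gives the first formula.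
  Expanding M S = e + K Q B - K Z^d B p with Q = Z^d D^\<pi> - Z^\<pi> D^d, where K Q B e = 0, turns it
  into the second.
\<close>

section \<open>Ring laws for products of rectangular matrices\<close>

lemma matrix_mul_lzero [simp]: "(0 :: 'a::semiring_1^'n^'m) ** X = 0"
  by (simp add: matrix_matrix_mult_def vec_eq_iff)

lemma matrix_mul_rzero [simp]: "X ** (0 :: 'a::semiring_1^'n^'m) = 0"
  by (simp add: matrix_matrix_mult_def vec_eq_iff)

lemma matrix_add_rdistrib:
  fixes W :: "'a::semiring_1^'n^'m"
  shows "(X + Y) ** W = X ** W + Y ** W"
  by (simp add: matrix_matrix_mult_def vec_eq_iff distrib_right sum.distrib)

lemma matrix_diff_ldistrib:
  fixes X :: "'a::ring_1^'n^'m"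
  shows "X ** (Y - W) = X ** Y - X ** W"
  by (simp add: matrix_matrix_mult_def vec_eq_iff right_diff_distrib sum_subtractf)

lemma matrix_diff_rdistrib:
  fixes W :: "'a::ring_1^'n^'m"
  shows "(X - Y) ** W = X ** W - Y ** W"
  by (simp add: matrix_matrix_mult_def vec_eq_iff left_diff_distrib sum_subtractf)

lemma matrix_sum_ldistrib:
  fixes X :: "'a::ring_1^'n^'m"
  shows "X ** (\<Sum>i\<in>I. f i) = (\<Sum>i\<in>I. X ** f i)"
  by (induction I rule: infinite_finite_induct) (simp_all add: matrix_add_ldistrib)

lemma matrix_sum_rdistrib:
  fixes X :: "'a::ring_1^'n^'m"
  shows "(\<Sum>i\<in>I. f i) ** X = (\<Sum>i\<in>I. f i ** X)"
  by (induction I rule: infinite_finite_induct) (simp_all add: matrix_add_rdistrib)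

lemmas matrix_distribs =
  matrix_add_ldistrib matrix_add_rdistrib matrix_diff_ldistrib matrix_diff_rdistrib

section \<open>Recognising Drazin inverses\<close>

lemma is_drazin_inverse_drazin_inverse: "is_drazin_inverse X X\<^sup>d"
  unfolding drazin_inverse_def by (rule theI') (rule drazin_inverse_ex1)

text \<open>The exponent j need not be the index of X, so no index has to be computed below.\<close>

lemma drazin_inverse_eqI:
  fixes X Y :: "complex^'n^'n"
  assumes comm: "X ** Y = Y ** X" and outer: "Y ** X ** Y = Y"
    and pow: "matpow X j = matpow X (Suc j) ** Y"
  shows "X\<^sup>d = Y"
proof -
  define k where "k = mat_ind X"
  have X: "X ** X\<^sup>d = X\<^sup>d ** X" "matpow X k = X\<^sup>d ** matpow X (Suc k)"
    using is_drazin_inverse_drazin_inverse[of X] matpow_mult_drazin[of X "X\<^sup>d"]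
    unfolding is_drazin_inverse_def k_def by (auto simp del: matpow.simps)
  \<comment> \<open>Reaches the exponent \<open>i + k\<close> from the index \<open>k\<close>, so
    that \<open>pow\<close> applies with \<open>i = j\<close>, even when \<open>j\<close> exceeds
    \<open>k\<close>.\<close>
  have lift: "matpow X k = matpow X\<^sup>d i ** matpow X (i + k)" for i
  proof (induction i)
    case (Suc i)
    have "matpow X\<^sup>d (Suc i) ** matpow X (Suc i + k)
        = matpow X\<^sup>d i ** (X\<^sup>d ** matpow X (Suc k)) ** matpow X i"
      by (simp only: matpow_Suc2[of "X\<^sup>d"] flip: matrix_mul_assoc matpow_add)
        (simp add: ac_simps)
    also have "\<dots> = matpow X\<^sup>d i ** matpow X (i + k)"
      by (simp only: X(2)[symmetric] flip: matrix_mul_assoc matpow_add) (simp add: ac_simps)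
    finally show ?case using Suc by simp
  qed simp
  have "matpow X (k + 1) ** Y = matpow X\<^sup>d j ** matpow X k ** (matpow X (Suc j) ** Y)"
  proof -
    have "X ** matpow X\<^sup>d j = matpow X\<^sup>d j ** X"
      using matpow_mult_drazin[of "X\<^sup>d" X j] X(1) by simp
    then have "matpow X (k + 1) = matpow X\<^sup>d j ** matpow X k ** matpow X (Suc j)"
      using arg_cong[OF lift[of j], of "\<lambda>M. X ** M"]
      by (simp add: matrix_mul_assoc)
        (simp add: matpow_add[symmetric] ac_simps flip: matrix_mul_assoc matpow.simps)
    then show ?thesis by (simp only: matrix_mul_assoc)
  qed
  also have "\<dots> = matpow X\<^sup>d j ** matpow X (j + k)"
    by (simp only: pow[symmetric] flip: matrix_mul_assoc matpow_add) (simp add: ac_simps)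
  also have "\<dots> = matpow X k" using lift by simp
  finally have "is_drazin_inverse X Y"
    using comm outer by (simp add: is_drazin_inverse_def k_def)
  then show ?thesis
    using is_drazin_inverse_unique is_drazin_inverse_drazin_inverse by blast
qed

text \<open>A solution \<open>V\<close> of the Sylvester equation
  \<open>S ** V - V ** N = e ** S ** p\<close> block-diagonalises \<open>S\<close>: the range of
  \<open>p - V\<close> is an invariant complement to that of \<open>e\<close>. The Drazin inverse
  inverts \<open>S\<close> on the range of \<open>e\<close> and vanishes on the complement, which
  gives \<open>M + M ** V\<close>. Nilpotency of \<open>N\<close> on \<open>p\<close> makes the
  series for \<open>V\<close> finite.\<close>

lemma drazin_inverse_block_triangular:
  fixes S M N e p :: "complex^'n^'n"
  assumes one: "e + p = mat 1" and eM: "e ** M = M" and pe: "p ** e = 0"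
    and SM: "S ** M = e" and MSe: "M ** S ** e = e"
    and pS: "p ** S = p ** N" and pN: "p ** N = N ** p" and nil: "matpow N k ** p = 0"
  shows "S\<^sup>d = M + (\<Sum>i<k. matpow M (i + 2) ** S ** matpow N i ** p)"
proof -
  have p: "p = mat 1 - e" using one by (simp add: algebra_simps)
  have ee: "e ** e = e" using pe by (simp add: p matrix_distribs)
  have pp: "p ** p = p" using ee by (simp add: p matrix_distribs)
  have pNi: "matpow N i ** p = p ** matpow N i" for i
    using matpow_mult_drazin[of N p i] pN by simp
  have Me: "M ** e = M"
    by (metis MSe SM eM matrix_mul_assoc)
  \<comment> \<open>The leading \<open>e\<close> matters only for \<open>i = 0\<close>, where
    \<open>S ** M = e\<close> leaves \<open>e ** S ** p\<close> as the first summand of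
    \<open>S ** V\<close>.\<close>
  define f where "f i = e ** matpow M i ** S ** matpow N i ** p" for i
  define V where "V = (\<Sum>i<k. matpow M (Suc i) ** S ** matpow N i ** p)"
  have eV: "e ** V = V"
    by (simp add: V_def matrix_sum_ldistrib matrix_mul_assoc eM)
  have Vp: "V ** p = V"
    by (simp add: V_def matrix_sum_rdistrib flip: matrix_mul_assoc) (simp add: pp)
  have Ve: "V ** e = 0"
    by (metis Vp pe matrix_mul_assoc matrix_mul_rzero)
  have SV: "S ** V = (\<Sum>i<k. f i)"
    by (simp add: V_def f_def matrix_sum_ldistrib matrix_mul_assoc SM)
  have VN: "V ** N = (\<Sum>i<k. f (Suc i))"
    unfolding V_def f_def matrix_sum_rdistrib
  proof (rule sum.cong[OF refl])
    fix i
    show "matpow M (Suc i) ** S ** matpow N i ** p ** N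
        = e ** matpow M (Suc i) ** S ** matpow N (Suc i) ** p"
      unfolding matpow_Suc2[of N]
      by (simp add: matrix_mul_assoc eM) (simp add: pN flip: matrix_mul_assoc)
  qed
  \<comment> \<open>The difference telescopes: \<open>f 0\<close> is the off-diagonal block of
    \<open>S\<close>, and \<open>f k\<close> contains the vanishing factor
    \<open>matpow N k ** p\<close>.\<close>
  have "S ** V - V ** N = f 0 - f k"
    unfolding SV VN sum_subtractf[symmetric] by (simp add: sum_lessThan_telescope')
  also have "f k = 0"
    by (simp add: f_def nil flip: matrix_mul_assoc)
  finally have SVN: "S ** V = e ** S ** p + V ** N"
    by (simp add: f_def algebra_simps)
  \<comment> \<open>Since \<open>M ** e = M\<close>, this is \<open>M ** (e + V)\<close>, where
    \<open>e + V\<close> projects onto the range of \<open>e\<close> along that of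
    \<open>p - V\<close>.\<close>
  define Y where "Y = M + M ** V"
  have SY: "S ** Y = e + V"
    by (simp add: Y_def matrix_distribs matrix_mul_assoc SM eV)
  have VS: "V ** S = V ** N"
    by (metis Vp pS matrix_mul_assoc)
  have MS: "M ** S - M ** S ** p = e"
    using MSe by (simp add: p matrix_distribs)
  have MSV: "M ** (S ** V) = V"
    by (metis eV MSe matrix_mul_assoc)
  have "Y ** S = M ** S + M ** (V ** N)"
    by (simp add: Y_def matrix_distribs VS flip: matrix_mul_assoc)
  also have "M ** (V ** N) = V - M ** S ** p"
    using MSV by (simp add: SVN matrix_distribs matrix_mul_assoc Me eq_diff_eq ac_simps)
  finally have "Y ** S = (M ** S - M ** S ** p) + V" by simp
  then have YS: "Y ** S = e + V" by (simp only: MS)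
  have VV: "V ** V = 0"
    by (metis Ve eV matrix_mul_assoc matrix_mul_lzero)
  have YSY: "Y ** S ** Y = Y"
    unfolding matrix_mul_assoc[symmetric] SY
    by (simp add: Y_def matrix_distribs Me Ve VV flip: matrix_mul_assoc)
  \<comment> \<open>Intertwining \<open>S\<close> with \<open>N\<close> transfers nilpotency:
    \<open>matpow S k\<close> kills \<open>p - V\<close>, which is
    \<open>mat 1 - S ** Y\<close>.\<close>
  have SpV: "S ** (p - V) = (p - V) ** N"
  proof -
    have "S ** p = e ** S ** p + p ** S ** p"
      by (simp add: p matrix_distribs)
    also have "p ** S ** p = p ** N"
      by (simp add: pS) (simp add: pN pp flip: matrix_mul_assoc)
    finally show ?thesis by (simp add: matrix_distribs SVN)
  qed
  have "matpow S j ** (p - V) = (p - V) ** matpow N j" for j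
  proof (induction j)
    case (Suc j)
    have "matpow S (Suc j) ** (p - V) = S ** (p - V) ** matpow N j"
      by (simp add: Suc flip: matrix_mul_assoc)
    then show ?case by (simp add: SpV matrix_mul_assoc)
  qed simp
  then have "matpow S k ** (p - V) = (p - V) ** matpow N k" .
  also have "\<dots> = (p - V) ** (matpow N k ** p)"
    by (simp add: pNi matrix_mul_assoc) (simp add: matrix_distribs Vp pp)
  finally have "matpow S k ** (p - V) = 0" by (simp add: nil)
  moreover have "p - V = mat 1 - S ** Y" by (simp add: SY p)
  ultimately have "matpow S k = matpow S (Suc k) ** Y"
    unfolding matpow_Suc2 by (simp add: matrix_distribs matrix_mul_assoc)
  then have "S\<^sup>d = Y"
    using SY YS YSY by (intro drazin_inverse_eqI[of S Y k]) simp_all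
  then show ?thesis
    by (simp add: Y_def V_def matrix_sum_ldistrib matrix_mul_assoc)
qed

section \<open>The two formulas for the generalised Schur complement\<close>

theorem theorem2p5:
  fixes A :: "complex^'n^'n" and D :: "complex^'m^'m"
    and B :: "complex^'n^'m" and C :: "complex^'m^'n"
    and S :: "complex^'n^'n" and Z :: "complex^'m^'m"
    and H :: "complex^'n^'m" and K :: "complex^'m^'n" and k :: nat
  assumes "S = A - C ** D\<^sup>d ** B"
    and "Z = D - B ** A\<^sup>d ** C"
    and "H = B ** A\<^sup>d"
    and "K = A\<^sup>d ** C"
    and "k = mat_ind A"
    and "A\<^sup>\<pi> ** C ** D\<^sup>d ** B = 0"
    and "K ** D\<^sup>\<pi> ** Z\<^sup>d ** H = K ** D\<^sup>d ** Z\<^sup>\<pi> ** H"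
  shows "S\<^sup>d = A\<^sup>d + K ** Z\<^sup>d ** H
           + (\<Sum>i<k. matpow (A\<^sup>d + K ** Z\<^sup>d ** H) (i + 2) ** S ** matpow A i ** A\<^sup>\<pi>)
       \<and>
         S\<^sup>d = A\<^sup>d + A\<^sup>d ** C ** Z\<^sup>d ** B ** A\<^sup>d
           - (\<Sum>i<k. matpow (A\<^sup>d + A\<^sup>d ** C ** Z\<^sup>d ** B ** A\<^sup>d) (i + 1)
                      ** A\<^sup>d ** C ** Z\<^sup>d ** B ** matpow A i ** A\<^sup>\<pi>)
           + (\<Sum>i<k. matpow (A\<^sup>d + A\<^sup>d ** C ** Z\<^sup>d ** B ** A\<^sup>d) (i + 1)
                      ** A\<^sup>d ** C ** (Z\<^sup>d ** D\<^sup>\<pi> - Z\<^sup>\<pi> ** D\<^sup>d) ** B ** matpow A i)"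
proof -
  define a where "a = A\<^sup>d"
  define e where "e = A ** a"
  define p where "p = A\<^sup>\<pi>"
  define M where "M = a + K ** Z\<^sup>d ** H"
  define Q where "Q = Z\<^sup>d ** D\<^sup>\<pi> - Z\<^sup>\<pi> ** D\<^sup>d"
  have aA: "a ** A = e" and aAa: "a ** A ** a = a" and Ak: "matpow A k = matpow A (Suc k) ** a"
    using is_drazin_inverse_drazin_inverse[of A]
    unfolding is_drazin_inverse_def e_def a_def assms(5) by auto
  have DDd: "D\<^sup>d ** D = D ** D\<^sup>d" and ZZd: "Z\<^sup>d ** Z = Z ** Z\<^sup>d"
    using is_drazin_inverse_drazin_inverse[of D] is_drazin_inverse_drazin_inverse[of Z]
    by (simp_all add: is_drazin_inverse_def)
  have p: "p = mat 1 - e" by (simp add: p_def e_def a_def spectral_idem_def)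
  then have one: "e + p = mat 1" by simp
  have ea: "e ** a = a" and ae: "a ** e = a"
    using aAa aA by (simp_all add: e_def matrix_mul_assoc)
  have ee: "e ** e = e" by (metis aA ae ea matrix_mul_assoc)
  have eA: "e ** A = A ** e" by (metis aA e_def matrix_mul_assoc)
  have pe: "p ** e = 0" and ep: "e ** p = 0" and pp: "p ** p = p"
    by (simp_all add: p matrix_distribs ee)
  have pA: "p ** A = A ** p" by (simp add: p matrix_distribs eA)
  have nil: "matpow A k ** p = 0"
    using Ak unfolding p e_def matpow_Suc2 by (simp add: matrix_distribs matrix_mul_assoc)
  have pC: "p ** C ** D\<^sup>d ** B = 0" using assms(6) by (simp add: p_def)
  have eM: "e ** M = M" and Me: "M ** e = M"
    by (simp_all add: M_def assms(3,4) matrix_distribs matrix_mul_assoc ea ae flip: a_def)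
      (simp add: ae flip: matrix_mul_assoc)
  have pS: "p ** S = p ** A"
    by (simp add: assms(1) matrix_distribs matrix_mul_assoc pC)
  have BaC: "B ** a ** C = D - Z" by (simp add: assms(2) a_def)
  \<comment> \<open>The inserted \<open>e\<close> allows \<open>e ** C\<close> to be written as
    \<open>A ** K\<close>, which brings in the second hypothesis.\<close>
  have CDB: "C ** D\<^sup>d ** B = e ** C ** D\<^sup>d ** B"
    using pC by (simp add: p matrix_distribs)
  have "S ** M = e + e ** C ** (Z\<^sup>d - D\<^sup>d - D\<^sup>d ** (B ** a ** C) ** Z\<^sup>d) ** B ** a"
    unfolding assms(1) M_def assms(3,4) a_def[symmetric] matrix_distribs
    by (subst (1 2) CDB) (simp add: matrix_mul_assoc matrix_distribs e_def)
  also have "Z\<^sup>d - D\<^sup>d - D\<^sup>d ** (B ** a ** C) ** Z\<^sup>d = D\<^sup>\<pi> ** Z\<^sup>d - D\<^sup>d ** Z\<^sup>\<pi>"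
    by (simp add: BaC spectral_idem_def matrix_distribs matrix_mul_assoc DDd)
  also have "e ** C ** (D\<^sup>\<pi> ** Z\<^sup>d - D\<^sup>d ** Z\<^sup>\<pi>) ** B ** a
      = A ** (K ** D\<^sup>\<pi> ** Z\<^sup>d ** H - K ** D\<^sup>d ** Z\<^sup>\<pi> ** H)"
    by (simp add: assms(3,4) e_def matrix_distribs matrix_mul_assoc flip: a_def)
  finally have SM: "S ** M = e" by (simp add: assms(7))
  have MSe: "M ** S ** e = e"
  proof -
    have pM: "p ** M = 0" and Mp: "M ** p = 0" by (simp_all add: p matrix_distribs eM Me)
    have pSe: "p ** S ** e = 0"
      by (simp add: pS pA) (simp add: pe flip: matrix_mul_assoc)
    \<comment> \<open>Adding p turns inverses in the corner ring of e into inverses in the full matrix ring.\<close>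
    have "(S ** e + p) ** (M + p) = mat 1"
      by (simp add: matrix_distribs pM pp flip: matrix_mul_assoc) (simp add: eM ep SM one)
    then have "(M + p) ** (S ** e + p) = mat 1"
      by (simp add: matrix_left_right_inverse)
    then show ?thesis
      by (simp add: matrix_distribs Mp pp pSe matrix_mul_assoc) (simp add: p)
  qed
  \<comment> \<open>Here \<open>Z\<close> and \<open>D\<close> occur in the opposite order to
    \<open>S ** M\<close>, so the hypothesis on \<open>K\<close> and \<open>H\<close> does not
    cancel the middle term and \<open>Q\<close> appears.\<close>
  have MS: "M ** S = e + K ** Q ** B - K ** Z\<^sup>d ** B ** p"
  proof -
    have "M ** S = e + K ** (Z\<^sup>d ** B ** e - D\<^sup>d ** B - Z\<^sup>d ** (B ** a ** C) ** D\<^sup>d ** B)"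
      by (simp add: assms(1,3,4) M_def matrix_distribs matrix_mul_assoc aA flip: a_def)
        (simp add: aA flip: matrix_mul_assoc)
    also have "Z\<^sup>d ** B ** e - D\<^sup>d ** B - Z\<^sup>d ** (B ** a ** C) ** D\<^sup>d ** B
        = Q ** B - Z\<^sup>d ** B ** p"
      by (simp add: BaC Q_def p spectral_idem_def matrix_distribs matrix_mul_assoc DDd ZZd)
    finally show ?thesis by (simp add: matrix_distribs matrix_mul_assoc)
  qed
  \<comment> \<open>The mirror image of the second hypothesis; it follows from \<open>M\<close>
    being also a left inverse in the corner of \<open>e\<close>.\<close>
  have KQB: "K ** Q ** B ** e = 0"
  proof -
    have "e = (e + K ** Q ** B - K ** Z\<^sup>d ** B ** p) ** e"
      using MSe by (simp add: MS)
    then show ?thesis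
      by (simp add: matrix_distribs ee) (simp add: pe flip: matrix_mul_assoc)
  qed
  have first: "S\<^sup>d = M + (\<Sum>i<k. matpow M (i + 2) ** S ** matpow A i ** p)"
    by (rule drazin_inverse_block_triangular[where e=e]) (use eM pe SM MSe pS pA nil p in auto)
  \<comment> \<open>One factor \<open>M\<close> is split off to meet \<open>S\<close>. By
    \<open>KQB\<close> the term with \<open>Q\<close> absorbs \<open>p\<close>, so only the other
    sum keeps \<open>A\<^sup>\<pi>\<close>.\<close>
  have "matpow M (i + 2) ** S ** matpow A i ** p
      = matpow M (i + 1) ** K ** Q ** B ** matpow A i
        - matpow M (i + 1) ** K ** Z\<^sup>d ** B ** matpow A i ** p" for i
  proof -
    have Aip: "matpow A i ** p = p ** matpow A i"
      using matpow_mult_drazin[of A p i] pA by simp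
    have "K ** Q ** B ** p = K ** Q ** B"
      using KQB by (simp add: p matrix_distribs)
    then have MSp: "M ** S ** p = K ** Q ** B - K ** Z\<^sup>d ** B ** p"
      by (simp add: MS matrix_distribs ep) (simp add: pp flip: matrix_mul_assoc)
    have "matpow M (i + 2) ** S ** matpow A i ** p
        = matpow M (i + 1) ** (M ** S ** p) ** matpow A i"
      using matpow_Suc2[of M "Suc i"]
      by (simp add: matrix_mul_assoc del: matpow.simps) (simp add: Aip flip: matrix_mul_assoc)
    also have "\<dots> = matpow M (i + 1) ** K ** Q ** B ** matpow A i
        - matpow M (i + 1) ** K ** Z\<^sup>d ** B ** (p ** matpow A i)"
      by (simp add: MSp matrix_distribs matrix_mul_assoc del: matpow.simps)
    finally show ?thesis by (simp add: matrix_mul_assoc del: matpow.simps flip: Aip)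
  qed
  then have second: "S\<^sup>d = M - (\<Sum>i<k. matpow M (i + 1) ** K ** Z\<^sup>d ** B ** matpow A i ** p)
        + (\<Sum>i<k. matpow M (i + 1) ** K ** Q ** B ** matpow A i)"
    unfolding first by (simp add: sum_subtractf)
  have "M = A\<^sup>d + A\<^sup>d ** C ** Z\<^sup>d ** B ** A\<^sup>d"
    by (simp add: M_def a_def assms(3,4) matrix_mul_assoc)
  then show ?thesis
    using first second unfolding M_def p_def Q_def a_def assms(3,4) by (simp add: matrix_mul_assoc)
qed

end
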